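(* Let $J^2_-$ be the set of $2$-jets with $\det(\mathrm{Hess}(u))=u_{xx}u_{yy}-u_{xy}^2<0$, and work where $u_{yy}\neq0$. Let $\mathcal{E}^1_-\subset J^3$ be the third-order PDE $$\begin{aligned}&\sqrt{-\det(\mathrm{Hess}(u))}\,\big(u_{xx}u_{yy}u_{yyy}-3u_{xxy}u_{yy}^2-4u_{xy}^2u_{yyy}+6u_{xy}u_{xyy}u_{yy}\big)\\&+\big(-3u_{xx}u_{xy}u_{yy}u_{yyy}+3u_{xx}u_{xyy}u_{yy}^2-u_{xxx}u_{yy}^3+3u_{xxy}u_{xy}u_{yy}^2+4u_{xy}^3u_{yyy}-6u_{xy}^2u_{xyy}u_{yy}\big)=0\end{aligned}$$ over $J^2_-$. For $a^2\in J^2_-$ let $$\mathcal{V}_{a^2}:=\bigcup_{a^3\in(\mathcal{E}^1_-)_{a^2}}l_{a^3}\subset\mathcal{C}^2_{a^2}$$ be the union of the characteristic lines $l_{a^3}$ as $a^3$ ranges over the fibre $(\mathcal{E}^1_-)_{a^2}$ of $\mathcal{E}^1_-$ over $a^2$. Then the distribution $J^2_-\ni a^2\mapsto\mathcal{V}_{a^2}\subset\mathcal{C}^2_{a^2}$ of conic subsets of $\mathcal{C}^2$ is a vector distribution, locally given by $$\mathcal{V}=\big\langle -u_{yy}D^{(2)}_x+bD^{(2)}_y\,,\;2b\,\partial_{u_{xx}}+u_{yy}\,\partial_{u_{xy}}\,,\;-b^2\,\partial_{u_{xx}}+u_{yy}^2\,\partial_{u_{yy}}\big\rangle,\qquad 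b=u_{xy}-\sqrt{-\det(\mathrm{Hess}(u))}.$$
   Context: $J^\ell$ denotes the space of $\ell$-jets of surfaces $u=u(x,y)$ of $\mathbb{R}^3$, with coordinates $x,y,u,u_x,u_y,u_{xx},u_{xy},u_{yy},u_{xxx},\dots$. On $J^2$ put $D^{(2)}_x=\partial_x+u_x\partial_u+u_{xx}\partial_{u_x}+u_{xy}\partial_{u_y}$ and $D^{(2)}_y=\partial_y+u_y\partial_u+u_{xy}\partial_{u_x}+u_{yy}\partial_{u_y}$. The second-order contact distribution $\mathcal{C}^2$ on $J^2$ is the $5$-dimensional distribution spanned by $D^{(2)}_x,D^{(2)}_y,\partial_{u_{xx}},\partial_{u_{xy}},\partial_{u_{yy}}$. For $a^3\in J^3$ over $a^2\in J^2$ put $$D^{(3)}_x=D^{(2)}_x+u_{xxx}\partial_{u_{xx}}+u_{xxy}\partial_{u_{xy}}+u_{xyy}\partial_{u_{yy}},\qquad D^{(3)}_y=D^{(2)}_y+u_{xxy}\partial_{u_{xx}}+u_{xyy}\partial_{u_{xy}}+u_{yyy}\partial_{u_{yy}},$$ regarded as tangent vectors to $J^2$ at $a^2$. For $a^3\in\mathcal{E}^1_-$ (so that $u_{xxx}$ is determined by the equation of $\mathcal{E}^1_-$) the characteristic line at $a^3$ is the line in $\mathcal{C}^2_{a^2}$ $$l_{a^3}=\Big\langle\sqrt{-\det(\mathrm{Hess}(u))}\,u_{yy}\,D^{(3)}_x-\big(\sqrt{-\det(\mathrm{Hess}(u))}\,u_{xy}+u_{xx}u_{yy}-u_{xy}^2\big)D^{(3)}_y\Big\rangle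 .$$
   Formalization: The union of the characteristic lines omits the nonzero vectors of the span that are vertical over 1-jets, so it is never a linear subspace; what is proved is that its closure is the stated rank-3 vector distribution and that the union is the span minus those vectors. *)

theory Defs
  imports "HOL-Analysis.Analysis"
begin

text \<open>Coordinates on the jet spaces. \<open>J\<^sup>2\<close> is the coordinate space with coordinates
  \<open>x, y, u, u\<^sub>x, u\<^sub>y, u\<^sub>x\<^sub>x, u\<^sub>x\<^sub>y, u\<^sub>y\<^sub>y\<close>; its tangent space at each point is identified
  with the space itself, so that \<open>axis c 1\<close> is the coordinate vector field \<open>\<partial>\<^sub>c\<close>.\<close>

datatype coord2 = Cx | Cy | Cu | Cux | Cuy | Cuxx | Cuxy | Cuyy

datatype coord3 = Low coord2 | Cuxxx | Cuxxy | Cuxyy | Cuyyy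

lemma UNIV_coord2: "(UNIV :: coord2 set) = {Cx, Cy, Cu, Cux, Cuy, Cuxx, Cuxy, Cuyy}"
  using coord2.exhaust by auto

lemma UNIV_coord3: "(UNIV :: coord3 set) = Low ` UNIV \<union> {Cuxxx, Cuxxy, Cuxyy, Cuyyy}"
  using coord3.exhaust by auto

instance coord2 :: finite
  by standard (simp add: UNIV_coord2)

instance coord3 :: finite
  by standard (simp add: UNIV_coord3)

type_synonym jet2 = "real ^ coord2"
type_synonym jet3 = "real ^ coord3"

definition proj32 :: "jet3 \<Rightarrow> jet2" where
  "proj32 a = (\<chi> c. a $ Low c)"

abbreviation pd :: "coord2 \<Rightarrow> jet2" where
  "pd c \<equiv> axis c 1"

definition Dx2 :: "jet2 \<Rightarrow> jet2" where
  "Dx2 a = pd Cx + (a $ Cux) *\<^sub>R pd Cu + (a $ Cuxx) *\<^sub>R pd Cux + (a $ Cuxy) *\<^sub>R pd Cuy"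

definition Dy2 :: "jet2 \<Rightarrow> jet2" where
  "Dy2 a = pd Cy + (a $ Cuy) *\<^sub>R pd Cu + (a $ Cuxy) *\<^sub>R pd Cux + (a $ Cuyy) *\<^sub>R pd Cuy"

definition contact2 :: "jet2 \<Rightarrow> jet2 set" where
  "contact2 a = span {Dx2 a, Dy2 a, pd Cuxx, pd Cuxy, pd Cuyy}"

definition Dx3 :: "jet3 \<Rightarrow> jet2" where
  "Dx3 a = Dx2 (proj32 a) +
     (a $ Cuxxx) *\<^sub>R pd Cuxx + (a $ Cuxxy) *\<^sub>R pd Cuxy + (a $ Cuxyy) *\<^sub>R pd Cuyy"

definition Dy3 :: "jet3 \<Rightarrow> jet2" where
  "Dy3 a = Dy2 (proj32 a) +
     (a $ Cuxxy) *\<^sub>R pd Cuxx + (a $ Cuxyy) *\<^sub>R pd Cuxy + (a $ Cuyyy) *\<^sub>R pd Cuyy"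

definition det_Hess :: "jet2 \<Rightarrow> real" where
  "det_Hess a = a $ Cuxx * a $ Cuyy - (a $ Cuxy)\<^sup>2"

definition J2_minus :: "jet2 set" where
  "J2_minus = {a. det_Hess a < 0}"

definition E1_minus :: "jet3 set" where
  "E1_minus = {a. proj32 a \<in> J2_minus \<and>
     (let uxx = a $ Low Cuxx; uxy = a $ Low Cuxy; uyy = a $ Low Cuyy;
          uxxx = a $ Cuxxx; uxxy = a $ Cuxxy; uxyy = a $ Cuxyy; uyyy = a $ Cuyyy
      in sqrt (- det_Hess (proj32 a)) *
           (uxx * uyy * uyyy - 3 * uxxy * uyy\<^sup>2 - 4 * uxy\<^sup>2 * uyyy + 6 * uxy * uxyy * uyy)
         + (- 3 * uxx * uxy * uyy * uyyy + 3 * uxx * uxyy * uyy\<^sup>2 - uxxx * uyy ^ 3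
            + 3 * uxxy * uxy * uyy\<^sup>2 + 4 * uxy ^ 3 * uyyy - 6 * uxy\<^sup>2 * uxyy * uyy) = 0)}"

definition char_line :: "jet3 \<Rightarrow> jet2 set" where
  "char_line a3 =
     (let a = proj32 a3; s = sqrt (- det_Hess a)
      in span {(s * a $ Cuyy) *\<^sub>R Dx3 a3
               - (s * a $ Cuxy + a $ Cuxx * a $ Cuyy - (a $ Cuxy)\<^sup>2) *\<^sub>R Dy3 a3})"

text \<open>The lines \<open>l\<close> are never vertical (tangent to the fibres of \<open>J\<^sup>2 \<rightarrow> J\<^sup>1\<close>) where
  \<open>u\<^sub>y\<^sub>y \<noteq> 0\<close>. Hence their set-theoretic union contains no non-zero vertical vector and is
  not closed; the corresponding linear subspace is its closure.\<close>

definition char_union :: "jet2 \<Rightarrow> jet2 set" where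
  "char_union a = \<Union> (char_line ` {a3 \<in> E1_minus. proj32 a3 = a})"

definition b_coeff :: "jet2 \<Rightarrow> real" where
  "b_coeff a = a $ Cuxy - sqrt (- det_Hess a)"

text \<open>\<open>C\<^sup>k\<close> maps on an open set, by iterated directional derivatives, and smooth
  distributions of rank \<open>r\<close> (vector subbundles of the tangent bundle) on an open set.\<close>

primrec Ck_on :: "nat \<Rightarrow> 'a::euclidean_space set \<Rightarrow> ('a \<Rightarrow> 'b::real_normed_vector) \<Rightarrow> bool" where
  "Ck_on 0 S f \<longleftrightarrow> continuous_on S f"
| "Ck_on (Suc k) S f \<longleftrightarrow>
     (\<forall>p\<in>S. f differentiable (at p)) \<and> (\<forall>v. Ck_on k S (\<lambda>p. frechet_derivative f (at p) v))"

definition smooth_on :: "'a::euclidean_space set \<Rightarrow> ('a \<Rightarrow> 'b::real_normed_vector) \<Rightarrow> bool" where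
  "smooth_on S f \<longleftrightarrow> (\<forall>k. Ck_on k S f)"

definition vector_distribution ::
    "nat \<Rightarrow> 'a::euclidean_space set \<Rightarrow> ('a \<Rightarrow> 'a set) \<Rightarrow> bool" where
  "vector_distribution r M D \<longleftrightarrow> open M \<and>
     (\<forall>p\<in>M. subspace (D p) \<and> dim (D p) = r) \<and>
     (\<forall>p\<in>M. \<exists>W. open W \<and> p \<in> W \<and> W \<subseteq> M \<and>
        (\<exists>X :: nat \<Rightarrow> 'a \<Rightarrow> 'a. (\<forall>i<r. smooth_on W (X i)) \<and>
           (\<forall>q\<in>W. D q = span ((\<lambda>i. X i q) ` {..<r}))))"

end

theory Submission
  imports Defs
begin

text \<open>Writing \<open>p, q, r\<close> for the second derivatives and \<open>s = \<surd>(q\<^sup>2 - p r)\<close>, \<open>b = q - s\<close> is a root of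
  \<open>t\<^sup>2 - 2 q t + p r\<close>.  Modulo this relation the equation of \<open>\<E>\<^sup>1\<^sub>-\<close> becomes the binary cubic
  \<open>r\<^sup>3 u\<^sub>x\<^sub>x\<^sub>x - 3 b r\<^sup>2 u\<^sub>x\<^sub>x\<^sub>y + 3 b\<^sup>2 r u\<^sub>x\<^sub>y\<^sub>y - b\<^sup>3 u\<^sub>y\<^sub>y\<^sub>y = 0\<close>, and the generator of the characteristic line is
  \<open>s (r D\<^sub>x - b D\<^sub>y)\<close>.  The cubic says precisely that the vertical part of this generator lies in the
  plane spanned by \<open>2 b \<partial>\<^sub>x\<^sub>x + r \<partial>\<^sub>x\<^sub>y\<close> and \<open>- b\<^sup>2 \<partial>\<^sub>x\<^sub>x + r\<^sup>2 \<partial>\<^sub>y\<^sub>y\<close>, and every vector of that plane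
  arises in this way.\<close>

section \<open>Calculus of \<open>C\<^sup>k\<close> maps\<close>

text \<open>A derivative at a point depends only on the germ there, and on an open set agreement on
  \<open>S\<close> gives equal germs at every point of \<open>S\<close>.\<close>

lemma Ck_on_cong:
  assumes "open S" "\<And>p. p \<in> S \<Longrightarrow> f p = g p"
  shows "Ck_on k S f \<longleftrightarrow> Ck_on k S g"
proof -
  \<comment> \<open>One implication for arbitrary \<open>f\<close>, \<open>g\<close>; the
    equivalence follows by exchanging them.\<close>
  have "Ck_on k S g" if "Ck_on k S f" "\<And>p. p \<in> S \<Longrightarrow> f p = g p" for f g :: "'a \<Rightarrow> 'b"
    using that
  proof (induction k arbitrary: f g)
    case 0
    then show ?case using continuous_on_cong by force
  next
    case (Suc k)
    have der: "(g has_derivative frechet_derivative f (at p)) (at p)" if "p \<in> S" for p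
      using Suc.prems that \<open>open S\<close>
      by (auto simp: frechet_derivative_works intro: has_derivative_transform_within_open)
    then have eq: "frechet_derivative f (at p) = frechet_derivative g (at p)" if "p \<in> S" for p
      using that by (intro frechet_derivative_at)
    have "Ck_on k S (\<lambda>p. frechet_derivative g (at p) v)" for v
    proof (rule Suc.IH)
      show "Ck_on k S (\<lambda>p. frechet_derivative f (at p) v)"
        using Suc.prems(1) by simp
    qed (simp only: eq)
    with der show ?case
      by (auto simp only: Ck_on.simps differentiable_def)
  qed
  with assms(2) show ?thesis by metis
qed

text \<open>Uniqueness of derivatives lets an explicit formula \<open>f'\<close> replace
  \<open>frechet_derivative\<close>; the product, inverse and square root rules below are all used
  through it.\<close>

lemma Ck_on_SucI:
  assumes "open S" "\<And>p. p \<in> S \<Longrightarrow> (f has_derivative f' p) (at p)" "\<And>v. Ck_on k S (\<lambda>p. f' p v)"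
  shows "Ck_on (Suc k) S f"
proof -
  have "frechet_derivative f (at p) = f' p" if "p \<in> S" for p
    using assms(2) that frechet_derivative_at by metis
  then have "Ck_on k S (\<lambda>p. frechet_derivative f (at p) v)" for v
    using Ck_on_cong[OF \<open>open S\<close>, of "\<lambda>p. frechet_derivative f (at p) v" "\<lambda>p. f' p v"] assms(3)
    by auto
  with assms(2) show ?thesis
    by (auto simp: differentiable_def)
qed

lemma Ck_on_Suc_has_derivative:
  "Ck_on (Suc k) S f \<Longrightarrow> p \<in> S \<Longrightarrow> (f has_derivative frechet_derivative f (at p)) (at p)"
  by (simp add: frechet_derivative_works)

lemma Ck_on_Suc_imp: "Ck_on (Suc k) S f \<Longrightarrow> Ck_on k S f"
proof (induction k arbitrary: f)
  case 0
  then show ?case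
    by (simp add: continuous_at_imp_continuous_on differentiable_imp_continuous_within)
qed auto

lemma Ck_on_const: "Ck_on k S (\<lambda>p. c)"
  by (induction k arbitrary: c) auto

lemma Ck_on_bounded_linear:
  assumes "bounded_linear f"
  shows "Ck_on k S f"
proof (cases k)
  case 0
  then show ?thesis by (simp add: assms linear_continuous_on)
next
  case (Suc m)
  have der: "(f has_derivative f) (at p)" for p
    by (rule bounded_linear_imp_has_derivative[OF assms])
  then have "frechet_derivative f (at p) = f" for p
    using frechet_derivative_at by metis
  with der show ?thesis
    by (auto simp: Suc differentiable_def Ck_on_const)
qed

lemma Ck_on_add:
  assumes "open S" "Ck_on k S f" "Ck_on k S g"
  shows "Ck_on k S (\<lambda>p. f p + g p)"
  using assms(2,3)
proof (induction k arbitrary: f g)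
  case 0
  then show ?case by (simp add: continuous_on_add)
next
  case (Suc k)
  note der = Ck_on_Suc_has_derivative
  show ?case
    by (rule Ck_on_SucI[OF \<open>open S\<close> has_derivative_add[OF der[OF Suc.prems(1)] der[OF Suc.prems(2)]]])
      (use Suc in auto)
qed

text \<open>Leibniz: a directional derivative is a sum of two terms of the same bilinear shape, each
  pairing one factor with a derivative of the other. The undifferentiated factor is lowered to order
  \<open>k\<close> by \<open>Ck_on_Suc_imp\<close>, so the induction must range over all
  \<open>f\<close> and \<open>g\<close>.\<close>

lemma Ck_on_bounded_bilinear:
  assumes "bounded_bilinear h" "open S" "Ck_on k S f" "Ck_on k S g"
  shows "Ck_on k S (\<lambda>p. h (f p) (g p))"
  using assms(3,4)
proof (induction k arbitrary: f g)
  case 0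
  then show ?case by (simp add: bounded_bilinear.continuous_on[OF assms(1)])
next
  case (Suc k)
  note der = Ck_on_Suc_has_derivative
  show ?case
    by (rule Ck_on_SucI[OF \<open>open S\<close> bounded_bilinear.FDERIV[OF assms(1) der[OF Suc.prems(1)] der[OF Suc.prems(2)]]])
      (use Suc in \<open>auto intro!: Ck_on_add[OF \<open>open S\<close>] Suc.IH intro: Ck_on_Suc_imp\<close>)
qed

lemmas Ck_on_scaleR = Ck_on_bounded_bilinear[OF bounded_bilinear_scaleR]
lemmas Ck_on_mult = Ck_on_bounded_bilinear[OF bounded_bilinear_mult]

text \<open>The derivative of \<open>1/f\<close> is a product of \<open>1/f\<close>,
  \<open>1/f\<close> and a derivative of \<open>f\<close>, so the claim at order \<open>k\<close>
  feeds order \<open>k + 1\<close>.\<close>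

lemma Ck_on_inverse:
  fixes f :: "'a::euclidean_space \<Rightarrow> real"
  assumes "open S" "Ck_on k S f" "\<And>p. p \<in> S \<Longrightarrow> f p \<noteq> 0"
  shows "Ck_on k S (\<lambda>p. inverse (f p))"
  using assms(2)
proof (induction k)
  case 0
  then show ?case using assms(3) by (simp add: continuous_on_inverse)
next
  case (Suc k)
  let ?D = "\<lambda>p. frechet_derivative f (at p)"
  have inv: "Ck_on k S (\<lambda>p. inverse (f p))"
    using Suc Ck_on_Suc_imp by blast
  have "((\<lambda>p. inverse (f p)) has_derivative (\<lambda>h. - 1 * (inverse (f p) * ?D p h * inverse (f p)))) (at p)"
    if "p \<in> S" for p
    using Deriv.has_derivative_inverse[OF assms(3)[OF that] Ck_on_Suc_has_derivative[OF Suc.prems that]]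
    by simp
  moreover have "Ck_on k S (\<lambda>p. - 1 * (inverse (f p) * ?D p v * inverse (f p)))" for v
    by (intro Ck_on_mult Ck_on_const inv \<open>open S\<close>) (use Suc.prems in simp)
  ultimately show ?case
    by (rule Ck_on_SucI[OF \<open>open S\<close>])
qed

text \<open>The derivative is \<open>f' / (2 sqrt f)\<close>; positivity of \<open>f\<close> makes
  \<open>sqrt f\<close> invertible, and its regularity one order lower closes the induction.\<close>

lemma Ck_on_sqrt:
  assumes "open S" "Ck_on k S f" "\<And>p. p \<in> S \<Longrightarrow> f p > 0"
  shows "Ck_on k S (\<lambda>p. sqrt (f p))"
  using assms(2)
proof (induction k)
  case 0
  then show ?case by (simp add: continuous_on_real_sqrt)
next
  case (Suc k)
  let ?D = "\<lambda>p. frechet_derivative f (at p)"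
  have "Ck_on k S (\<lambda>p. sqrt (f p))"
    using Suc Ck_on_Suc_imp by blast
  then have inv: "Ck_on k S (\<lambda>p. inverse (sqrt (f p)))"
    using assms by (intro Ck_on_inverse) (auto simp: less_imp_neq[symmetric])
  have "((\<lambda>p. sqrt (f p)) has_derivative (\<lambda>h. 1/2 * inverse (sqrt (f p)) * ?D p h)) (at p)"
    if "p \<in> S" for p
    using has_derivative_real_sqrt[OF assms(3)[OF that] Ck_on_Suc_has_derivative[OF Suc.prems that]]
    by (simp add: field_simps)
  moreover have "Ck_on k S (\<lambda>p. 1/2 * inverse (sqrt (f p)) * ?D p v)" for v
    by (intro Ck_on_mult Ck_on_const inv \<open>open S\<close>) (use Suc.prems in simp)
  ultimately show ?case
    by (rule Ck_on_SucI[OF \<open>open S\<close>])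
qed

section \<open>The frame\<close>

text \<open>Indexed by \<open>nat\<close> to serve as the family of fields in
  \<open>vector_distribution\<close>. Index 0 is the only field with a component along
  \<open>pd Cx\<close>; all indices from 2 on repeat the third field, so smoothness holds for every
  \<open>i\<close>.\<close>

definition char_frame :: "nat \<Rightarrow> jet2 \<Rightarrow> jet2" where
  "char_frame i a =
     (if i = 0 then - (a $ Cuyy) *\<^sub>R Dx2 a + b_coeff a *\<^sub>R Dy2 a
      else if i = 1 then (2 * b_coeff a) *\<^sub>R pd Cuxx + (a $ Cuyy) *\<^sub>R pd Cuxy
      else - ((b_coeff a)\<^sup>2) *\<^sub>R pd Cuxx + (a $ Cuyy)\<^sup>2 *\<^sub>R pd Cuyy)"

lemma all_coord2:
  "(\<forall>c. P c) \<longleftrightarrow> P Cx \<and> P Cy \<and> P Cu \<and> P Cux \<and> P Cuy \<and> P Cuxx \<and> P Cuxy \<and> P Cuyy"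
  by (metis coord2.exhaust)

lemma in_span_3:
  fixes u v w :: "'a::real_vector"
  shows "x \<in> span {u, v, w} \<longleftrightarrow> (\<exists>k l m. x = k *\<^sub>R u + l *\<^sub>R v + m *\<^sub>R w)"
proof
  assume "x \<in> span {u, v, w}"
  then obtain k l m where "x - k *\<^sub>R u - l *\<^sub>R v = m *\<^sub>R w"
    by (auto simp: span_insert span_singleton)
  then have "x = k *\<^sub>R u + l *\<^sub>R v + m *\<^sub>R w"
    by (simp add: algebra_simps)
  then show "\<exists>k l m. x = k *\<^sub>R u + l *\<^sub>R v + m *\<^sub>R w" by blast
next
  assume "\<exists>k l m. x = k *\<^sub>R u + l *\<^sub>R v + m *\<^sub>R w"
  then show "x \<in> span {u, v, w}"
    by clarify (intro span_add span_scale span_base; simp)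
qed

lemma frame_image: "(\<lambda>i. f i) ` {..<3::nat} = {f 0, f 1, f 2}"
  by (auto simp: numeral_3_eq_3 numeral_2_eq_2 lessThan_Suc)

lemma sqrt_det_Hess:
  assumes "a \<in> J2_minus"
  shows "sqrt (- det_Hess a) > 0"
    "(sqrt (- det_Hess a))\<^sup>2 = (a $ Cuxy)\<^sup>2 - a $ Cuxx * a $ Cuyy"
  using assms by (auto simp: J2_minus_def det_Hess_def)

section \<open>Openness of the generic set and smoothness of the frame\<close>

lemma continuous_det_Hess: "continuous_on UNIV det_Hess"
  unfolding det_Hess_def by (intro continuous_intros)

lemma open_generic: "open {a \<in> J2_minus. a $ Cuyy \<noteq> 0}"
  unfolding J2_minus_def Collect_conj_eq[symmetric] mem_Collect_eq
  by (intro open_Collect_conj open_Collect_less open_Collect_neq continuous_det_Hess continuous_intros)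

lemma Ck_on_component: "Ck_on k S (\<lambda>a :: jet2. a $ c)"
  by (rule Ck_on_bounded_linear) (rule bounded_linear_vec_nth)

lemma Ck_on_b_coeff:
  assumes "open S" "S \<subseteq> J2_minus"
  shows "Ck_on k S b_coeff"
proof -
  \<comment> \<open>The Hessian is spelled with sums, products and constants only, so that the rules
    above apply; the same is done for \<open>b_coeff\<close> and the frame.\<close>
  have "Ck_on k S (\<lambda>a. - 1 * (a $ Cuxx * a $ Cuyy + - 1 * (a $ Cuxy * a $ Cuxy)))"
    by (intro Ck_on_add Ck_on_mult Ck_on_const Ck_on_component assms)
  then have "Ck_on k S (\<lambda>a. - det_Hess a)"
    by (simp add: det_Hess_def power2_eq_square)
  then have "Ck_on k S (\<lambda>a. sqrt (- det_Hess a))"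
    by (rule Ck_on_sqrt[OF \<open>open S\<close>]) (use assms in \<open>auto simp: J2_minus_def\<close>)
  then have "Ck_on k S (\<lambda>a. a $ Cuxy + - 1 * sqrt (- det_Hess a))"
    by (intro Ck_on_add Ck_on_mult Ck_on_const Ck_on_component assms)
  moreover have "b_coeff = (\<lambda>a. a $ Cuxy + - 1 * sqrt (- det_Hess a))"
    by (auto simp: b_coeff_def)
  ultimately show ?thesis by simp
qed

lemma smooth_on_char_frame:
  assumes "open S" "S \<subseteq> J2_minus"
  shows "smooth_on S (char_frame i)"
  unfolding smooth_on_def
proof
  fix k
  note C = Ck_on_add Ck_on_mult Ck_on_scaleR Ck_on_const Ck_on_component assms Ck_on_b_coeff
  have D: "Ck_on k S Dx2" "Ck_on k S Dy2"
    unfolding Dx2_def Dy2_def by (intro C)+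
  have "Ck_on k S (\<lambda>a. (- 1 * a $ Cuyy) *\<^sub>R Dx2 a + b_coeff a *\<^sub>R Dy2 a)"
    "Ck_on k S (\<lambda>a. (2 * b_coeff a) *\<^sub>R pd Cuxx + (a $ Cuyy) *\<^sub>R pd Cuxy)"
    "Ck_on k S (\<lambda>a. (- 1 * (b_coeff a * b_coeff a)) *\<^sub>R pd Cuxx + (a $ Cuyy * a $ Cuyy) *\<^sub>R pd Cuyy)"
    by (intro C D)+
  then show "Ck_on k S (char_frame i)"
    by (cases "i = 0"; cases "i = 1") (simp_all add: char_frame_def[abs_def] power2_eq_square)
qed

section \<open>Linear independence of the frame\<close>

lemma char_frame_components:
  "char_frame 0 a $ Cx = - (a $ Cuyy)"
  "char_frame (Suc 0) a $ Cx = 0" "char_frame 2 a $ Cx = 0"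
  "char_frame (Suc 0) a $ Cuxy = a $ Cuyy" "char_frame 2 a $ Cuxy = 0"
  "char_frame 2 a $ Cuyy = (a $ Cuyy)\<^sup>2"
  by (simp_all add: char_frame_def Dx2_def Dy2_def axis_def)

text \<open>On the components \<open>Cx\<close>, \<open>Cuxy\<close>, \<open>Cuyy\<close> the frame
  has a triangular matrix with diagonal \<open>-r, r, r^2\<close>, where \<open>r = a $ Cuyy\<close>
  is nonzero.\<close>

lemma dim_span_char_frame:
  assumes "a $ Cuyy \<noteq> 0"
  shows "dim (span {char_frame 0 a, char_frame 1 a, char_frame 2 a}) = 3"
proof -
  let ?w = "char_frame 0 a" and ?u = "char_frame 1 a" and ?v = "char_frame 2 a"
  have v: "?v \<noteq> 0"
    using assms char_frame_components(6)[of a] by auto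
  have u: "?u \<notin> span {?v}"
  proof
    assume "?u \<in> span {?v}"
    then obtain k where "?u = k *\<^sub>R ?v" by (auto simp: span_singleton)
    then have "?u $ Cuxy = (k *\<^sub>R ?v) $ Cuxy" by simp
    then show False using assms by (simp add: char_frame_components)
  qed
  have w: "?w \<notin> span {?u, ?v}"
  proof
    assume "?w \<in> span {?u, ?v}"
    then obtain k l where "?w - k *\<^sub>R ?u = l *\<^sub>R ?v" by (auto simp: span_insert span_singleton)
    then have "(?w - k *\<^sub>R ?u) $ Cx = (l *\<^sub>R ?v) $ Cx" by simp
    then show False using assms by (simp add: char_frame_components)
  qed
  have "independent {?w, ?u, ?v}"
    using u v w by (simp add: independent_insert)
  moreover have "card {?w, ?u, ?v} = 3"
    using u w span_base[of ?u "{?v}"] span_base[of ?w "{?u, ?v}"] by (subst card_3_iff) blast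
  ultimately show ?thesis
    using dim_eq_card_independent by fastforce
qed

lemma char_frame_in_contact2: "char_frame i a \<in> contact2 a"
proof -
  have "Dx2 a \<in> contact2 a" "Dy2 a \<in> contact2 a"
    "pd Cuxx \<in> contact2 a" "pd Cuxy \<in> contact2 a" "pd Cuyy \<in> contact2 a"
    by (auto simp: contact2_def span_base)
  moreover have "subspace (contact2 a)" by (simp add: contact2_def)
  ultimately show ?thesis
    unfolding char_frame_def by (auto intro!: subspace_add subspace_diff subspace_scale)
qed

section \<open>The characteristic cone\<close>

text \<open>The right side is the cubic form of third derivatives evaluated on the direction
  \<open>(r, -b)\<close> in the \<open>(x, y)\<close>-plane.\<close>

lemma E1_minus_iff_cubic:
  assumes "proj32 a3 = a" "a \<in> J2_minus"
  shows "a3 \<in> E1_minus \<longleftrightarrow>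
    (a $ Cuyy) ^ 3 * a3 $ Cuxxx - 3 * b_coeff a * (a $ Cuyy)\<^sup>2 * a3 $ Cuxxy
    + 3 * (b_coeff a)\<^sup>2 * a $ Cuyy * a3 $ Cuxyy - (b_coeff a) ^ 3 * a3 $ Cuyyy = 0"
    (is "_ \<longleftrightarrow> ?c = 0")
proof -
  define p q r s where "p = a $ Cuxx" and "q = a $ Cuxy" and "r = a $ Cuyy"
    and "s = sqrt (- det_Hess a)"
  define A B C D where "A = a3 $ Cuxxx" and "B = a3 $ Cuxxy" and "C = a3 $ Cuxyy" and "D = a3 $ Cuyyy"
  have low: "a3 $ Low c = a $ c" for c
    using assms(1) by (auto simp: proj32_def)
  have s2: "s\<^sup>2 = q\<^sup>2 - p * r"
    using sqrt_det_Hess(2)[OF assms(2)] by (simp add: s_def p_def q_def r_def)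
  have s3: "s ^ 3 = s * (q\<^sup>2 - p * r)"
    using s2 by (simp add: power3_eq_cube power2_eq_square)
  have b: "b_coeff a = q - s"
    by (simp add: b_coeff_def q_def s_def)
  \<comment> \<open>Reducing by \<open>s^2 = q^2 - p r\<close> makes the powers of \<open>b\<close>
    linear in \<open>s\<close>; what remains is a polynomial identity, with the given equation equal
    to minus the cubic.\<close>
  have b2: "(q - s)\<^sup>2 = 2 * q\<^sup>2 - 2 * q * s - p * r"
    using s2 by (simp add: power2_eq_square algebra_simps)
  have b3: "(q - s) ^ 3 = 4 * q ^ 3 - 3 * p * q * r - s * (4 * q\<^sup>2 - p * r)"
    using s2 s3 by algebra
  have eq: "s * (p * r * D - 3 * B * r\<^sup>2 - 4 * q\<^sup>2 * D + 6 * q * C * r)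
         + (- 3 * p * q * r * D + 3 * p * C * r\<^sup>2 - A * r ^ 3
            + 3 * B * q * r\<^sup>2 + 4 * q ^ 3 * D - 6 * q\<^sup>2 * C * r) = - ?c" (is "?e = _")
    unfolding b b2 b3 A_def[symmetric] B_def[symmetric] C_def[symmetric] D_def[symmetric]
      p_def[symmetric] q_def[symmetric] r_def[symmetric]
    by (simp add: algebra_simps power2_eq_square power3_eq_cube)
  have "a3 \<in> E1_minus \<longleftrightarrow> ?e = 0"
    using assms
    by (simp only: E1_minus_def low Let_def A_def B_def C_def D_def p_def q_def r_def s_def mem_Collect_eq simp_thms)
  then show ?thesis
    by (simp only: eq neg_equal_0_iff_equal)
qed

text \<open>Since \<open>p r - q^2 = - s^2\<close>, the second coefficient of the generator is
  \<open>s q - s^2 = s b\<close>. The nonzero factor \<open>- s\<close> then comes out and does not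
  change the line.\<close>

lemma char_line_eq_span:
  assumes "proj32 a3 = a" "a \<in> J2_minus"
  shows "char_line a3 = span {- (a $ Cuyy) *\<^sub>R Dx3 a3 + b_coeff a *\<^sub>R Dy3 a3}"
proof -
  define s where "s = sqrt (- det_Hess a)"
  let ?g = "- (a $ Cuyy) *\<^sub>R Dx3 a3 + b_coeff a *\<^sub>R Dy3 a3"
  have s: "s > 0" "s\<^sup>2 = (a $ Cuxy)\<^sup>2 - a $ Cuxx * a $ Cuyy"
    using sqrt_det_Hess[OF assms(2)] by (auto simp: s_def)
  have c: "s * a $ Cuxy + a $ Cuxx * a $ Cuyy - (a $ Cuxy)\<^sup>2 = s * b_coeff a"
    using s(2) by (simp add: b_coeff_def s_def[symmetric] power2_eq_square algebra_simps)
  have "char_line a3 = span {(- s) *\<^sub>R ?g}"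
    unfolding char_line_def Let_def assms(1) s_def[symmetric] c
    by (simp add: algebra_simps)
  also have "\<dots> = span {?g}"
    using span_image_scale[of "{?g}" "\<lambda>_. - s"] s(1) by simp
  finally show ?thesis .
qed

text \<open>The coefficients of \<open>char_frame 1\<close> and \<open>char_frame 2\<close> are
  forced by the \<open>Cuxy\<close> and \<open>Cuyy\<close> components; the \<open>Cuxx\<close>
  component then agrees exactly because of the cubic.\<close>

lemma char_generator_eq:
  assumes "proj32 a3 = a" "a \<in> J2_minus" "a $ Cuyy \<noteq> 0" "a3 \<in> E1_minus"
  shows "- (a $ Cuyy) *\<^sub>R Dx3 a3 + b_coeff a *\<^sub>R Dy3 a3 =
    char_frame 0 a
    + ((- (a $ Cuyy) * a3 $ Cuxxy + b_coeff a * a3 $ Cuxyy) / a $ Cuyy) *\<^sub>R char_frame 1 a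
    + ((- (a $ Cuyy) * a3 $ Cuxyy + b_coeff a * a3 $ Cuyyy) / (a $ Cuyy)\<^sup>2) *\<^sub>R char_frame 2 a"
proof -
  define r b where "r = a $ Cuyy" and "b = b_coeff a"
  define A B C D where "A = a3 $ Cuxxx" and "B = a3 $ Cuxxy" and "C = a3 $ Cuxyy" and "D = a3 $ Cuyyy"
  have r: "r \<noteq> 0" using assms(3) by (simp add: r_def)
  have "r ^ 3 * A - 3 * b * r\<^sup>2 * B + 3 * b\<^sup>2 * r * C - b ^ 3 * D = 0"
    using E1_minus_iff_cubic[OF assms(1,2)] assms(4)
    by (simp add: r_def b_def A_def B_def C_def D_def)
  then have A: "A = (3 * b * r\<^sup>2 * B - 3 * b\<^sup>2 * r * C + b ^ 3 * D) / r ^ 3"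
    using r by (simp add: field_simps)
  have xx: "- r * A + b * B = 2 * b * ((- r * B + b * C) / r) - b\<^sup>2 * ((- r * C + b * D) / r\<^sup>2)"
    unfolding A using r by (simp add: field_simps power2_eq_square power3_eq_cube)
  have xy: "- r * B + b * C = (- r * B + b * C) / r * r"
    and yy: "- r * C + b * D = (- r * C + b * D) / r\<^sup>2 * r\<^sup>2"
    using r by auto
  show ?thesis
    unfolding r_def[symmetric] b_def[symmetric] A_def[symmetric] B_def[symmetric] C_def[symmetric]
      D_def[symmetric] vec_eq_iff all_coord2
    using xx xy yy
    by (simp add: char_frame_def Dx3_def Dy3_def Dx2_def Dy2_def axis_def assms(1)
        A_def[symmetric] B_def[symmetric] C_def[symmetric] D_def[symmetric] r_def[symmetric]
        b_def[symmetric] mult.commute del: times_divide_eq_right times_divide_eq_left)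
qed

text \<open>The generator always has coefficient 1 on \<open>char_frame 0\<close>, while its other
  two coefficients take arbitrary values over the fibre. The union is therefore the cone over an
  affine plane.\<close>

lemma char_union_eq:
  assumes "a \<in> J2_minus" "a $ Cuyy \<noteq> 0"
  shows "char_union a =
    {t *\<^sub>R (char_frame 0 a + \<beta> *\<^sub>R char_frame 1 a + \<gamma> *\<^sub>R char_frame 2 a) |t \<beta> \<gamma>. True}"
    (is "_ = ?R")
proof
  show "char_union a \<subseteq> ?R"
    using char_generator_eq[OF _ assms] char_line_eq_span[OF _ assms(1)]
    by (fastforce simp: char_union_def span_singleton)
next
  show "?R \<subseteq> char_union a"
  proof clarify
    fix t \<beta> \<gamma>
    define r b where "r = a $ Cuyy" and "b = b_coeff a"
    have r: "r \<noteq> 0" using assms by (simp add: r_def)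
    \<comment> \<open>Two prescribed values \<open>\<beta>\<close>, \<open>\<gamma>\<close>
      constrain three free jets, so \<open>u_yyy\<close> is set to 0. Then \<open>C\<close> solves
      the equation for \<open>\<gamma>\<close>, \<open>B\<close> that for \<open>\<beta>\<close>,
      and \<open>A\<close> the cubic.\<close>
    define C where "C = - r * \<gamma>"
    define B where "B = (b * C) / r - \<beta>"
    define A where "A = (3 * b * r\<^sup>2 * B - 3 * b\<^sup>2 * r * C) / r ^ 3"
    define a3 :: jet3 where
      "a3 = (\<chi> c. case c of Low d \<Rightarrow> a $ d | Cuxxx \<Rightarrow> A | Cuxxy \<Rightarrow> B | Cuxyy \<Rightarrow> C | Cuyyy \<Rightarrow> 0)"
    have a3: "a3 $ Cuxxx = A" "a3 $ Cuxxy = B" "a3 $ Cuxyy = C" "a3 $ Cuyyy = 0"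
      by (simp_all add: a3_def)
    have proj: "proj32 a3 = a"
      by (simp add: proj32_def a3_def vec_eq_iff)
    have "r ^ 3 * A - 3 * b * r\<^sup>2 * B + 3 * b\<^sup>2 * r * C - b ^ 3 * 0 = 0"
      using r by (simp add: A_def)
    then have E: "a3 \<in> E1_minus"
      unfolding E1_minus_iff_cubic[OF proj assms(1)] a3 r_def b_def .
    have "(- r * B + b * C) / r = \<beta>" "(- r * C + b * 0) / r\<^sup>2 = \<gamma>"
      using r by (auto simp: B_def C_def field_simps power2_eq_square)
    then have "char_line a3 = span {char_frame 0 a + \<beta> *\<^sub>R char_frame 1 a + \<gamma> *\<^sub>R char_frame 2 a}"
      using char_line_eq_span[OF proj assms(1)] char_generator_eq[OF proj assms E]
      by (simp only: a3 r_def b_def)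
    then show "t *\<^sub>R (char_frame 0 a + \<beta> *\<^sub>R char_frame 1 a + \<gamma> *\<^sub>R char_frame 2 a) \<in> char_union a"
      using E proj by (auto simp: char_union_def span_singleton intro!: exI[of _ a3])
  qed
qed

section \<open>Comparison of the cone with its linear span\<close>

lemma char_union_eq_diff:
  assumes "a \<in> J2_minus" "a $ Cuyy \<noteq> 0"
  shows "char_union a = span {char_frame 0 a, char_frame 1 a, char_frame 2 a}
    - (span {pd Cuxx, pd Cuxy, pd Cuyy} - {0})" (is "_ = ?V - (?W - {0})")
proof -
  \<comment> \<open>The \<open>Cx\<close> component detects verticality: on the cone it equals
    \<open>- t r\<close>, which vanishes only for \<open>t = 0\<close>, that is, at the zero
    vector.\<close>
  have W0: "x $ Cx = 0" if "x \<in> ?W" for x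
    using that unfolding in_span_3 by (auto simp: axis_def)
  have "char_frame 1 a = (2 * b_coeff a) *\<^sub>R pd Cuxx + (a $ Cuyy) *\<^sub>R pd Cuxy + 0 *\<^sub>R pd Cuyy"
    "char_frame 2 a = (- ((b_coeff a)\<^sup>2)) *\<^sub>R pd Cuxx + 0 *\<^sub>R pd Cuxy + (a $ Cuyy)\<^sup>2 *\<^sub>R pd Cuyy"
    by (simp_all add: char_frame_def)
  then have fW: "char_frame 1 a \<in> ?W" "char_frame 2 a \<in> ?W"
    unfolding in_span_3 by blast+
  show ?thesis
  proof (intro equalityI subsetI)
    fix x assume "x \<in> char_union a"
    then obtain t \<beta> \<gamma> where
      x: "x = t *\<^sub>R (char_frame 0 a + \<beta> *\<^sub>R char_frame 1 a + \<gamma> *\<^sub>R char_frame 2 a)"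
      unfolding char_union_eq[OF assms] by blast
    have "x $ Cx = - t * a $ Cuyy"
      by (simp add: x char_frame_components)
    then have "x \<notin> ?W - {0}"
      using W0[of x] assms(2) x by auto
    moreover have "x \<in> ?V"
      unfolding x by (intro span_scale span_add span_base) auto
    ultimately show "x \<in> ?V - (?W - {0})" by blast
  next
    fix x assume x: "x \<in> ?V - (?W - {0})"
    then have "x \<in> ?V" by blast
    then obtain k l m where
      klm: "x = k *\<^sub>R char_frame 0 a + l *\<^sub>R char_frame 1 a + m *\<^sub>R char_frame 2 a"
      unfolding in_span_3 by blast
    show "x \<in> char_union a"
    proof (cases "k = 0")
      case True
      \<comment> \<open>Without a \<open>char_frame 0\<close> part \<open>x\<close> is vertical, so
        it must be 0, which is the cone point with \<open>t = 0\<close>.\<close>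
      then have "x \<in> ?W"
        unfolding klm using fW by (auto intro!: span_add span_scale)
      with x have "x = 0 *\<^sub>R (char_frame 0 a + 0 *\<^sub>R char_frame 1 a + 0 *\<^sub>R char_frame 2 a)" by simp
      then show ?thesis unfolding char_union_eq[OF assms] by blast
    next
      case False
      then have "x = k *\<^sub>R (char_frame 0 a + (l / k) *\<^sub>R char_frame 1 a + (m / k) *\<^sub>R char_frame 2 a)"
        by (simp add: klm algebra_simps)
      then show ?thesis unfolding char_union_eq[OF assms] by blast
    qed
  qed
qed

text \<open>The span is closed, and the vertical vectors missing from the cone are limits of
  non-vertical ones in the span.\<close>

lemma closure_char_union:
  assumes "a \<in> J2_minus" "a $ Cuyy \<noteq> 0"
  shows "closure (char_union a) = span {char_frame 0 a, char_frame 1 a, char_frame 2 a}" (is "_ = ?V")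
proof
  show "closure (char_union a) \<subseteq> ?V"
    by (rule closure_minimal) (auto simp: char_union_eq_diff[OF assms] closed_span)
  show "?V \<subseteq> closure (char_union a)"
  proof
    fix x assume "x \<in> ?V"
    then obtain k l m where
      klm: "x = k *\<^sub>R char_frame 0 a + l *\<^sub>R char_frame 1 a + m *\<^sub>R char_frame 2 a"
      unfolding in_span_3 by blast
    show "x \<in> closure (char_union a)"
    proof (cases "k = 0")
      case False
      then have "x = k *\<^sub>R (char_frame 0 a + (l / k) *\<^sub>R char_frame 1 a + (m / k) *\<^sub>R char_frame 2 a)"
        by (simp add: klm algebra_simps)
      then have "x \<in> char_union a" unfolding char_union_eq[OF assms] by blast
      then show ?thesis using closure_subset by blast
    next
      case True
      \<comment> \<open>A perturbation by \<open>char_frame 0 / (n + 1)\<close> leaves the vertical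
        plane. Factoring out \<open>1 / (n + 1)\<close> restores coefficient 1 on
        \<open>char_frame 0\<close> and multiplies \<open>l\<close> and \<open>m\<close> by
        \<open>n + 1\<close>.\<close>
      let ?f = "\<lambda>n. inverse (real (Suc n)) *\<^sub>R char_frame 0 a + x"
      have "?f n = inverse (real (Suc n)) *\<^sub>R (char_frame 0 a
        + (real (Suc n) * l) *\<^sub>R char_frame 1 a + (real (Suc n) * m) *\<^sub>R char_frame 2 a)" for n
        using True by (simp add: klm scaleR_add_right mult.assoc[symmetric] del: of_nat_Suc)
      then have "?f n \<in> char_union a" for n
        unfolding char_union_eq[OF assms] by blast
      moreover have "?f \<longlonglongrightarrow> 0 *\<^sub>R char_frame 0 a + x"
        by (intro tendsto_intros LIMSEQ_inverse_real_of_nat)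
      ultimately show ?thesis
        unfolding closure_sequential by (intro exI[of _ ?f]) simp
    qed
  qed
qed

theorem proposition6p1:
  fixes M :: "jet2 set"
  assumes M_def: "M = {a \<in> J2_minus. a $ Cuyy \<noteq> 0}"
  shows "(\<forall>a\<in>M. char_union a \<subseteq> contact2 a)
    \<and> vector_distribution 3 M (\<lambda>a. closure (char_union a))
    \<and> (\<forall>a\<in>M.
         let b = b_coeff a;
             V = span {- (a $ Cuyy) *\<^sub>R Dx2 a + b *\<^sub>R Dy2 a,
                       (2 * b) *\<^sub>R pd Cuxx + (a $ Cuyy) *\<^sub>R pd Cuxy,
                       - (b\<^sup>2) *\<^sub>R pd Cuxx + (a $ Cuyy)\<^sup>2 *\<^sub>R pd Cuyy}
         in closure (char_union a) = V
          \<and> char_union a = V - (span {pd Cuxx, pd Cuxy, pd Cuyy} - {0}))"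
proof (intro conjI ballI)
  fix a assume "a \<in> M"
  then have a: "a \<in> J2_minus" "a $ Cuyy \<noteq> 0" by (auto simp: M_def)
  have "span {char_frame 0 a, char_frame 1 a, char_frame 2 a} \<subseteq> contact2 a"
    by (rule span_minimal) (auto simp: char_frame_in_contact2, simp add: contact2_def)
  then show "char_union a \<subseteq> contact2 a"
    unfolding char_union_eq_diff[OF a] by blast
next
  fix a assume "a \<in> M"
  then have a: "a \<in> J2_minus" "a $ Cuyy \<noteq> 0" by (auto simp: M_def)
  show "let b = b_coeff a;
             V = span {- (a $ Cuyy) *\<^sub>R Dx2 a + b *\<^sub>R Dy2 a,
                       (2 * b) *\<^sub>R pd Cuxx + (a $ Cuyy) *\<^sub>R pd Cuxy,
                       - (b\<^sup>2) *\<^sub>R pd Cuxx + (a $ Cuyy)\<^sup>2 *\<^sub>R pd Cuyy}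
         in closure (char_union a) = V
          \<and> char_union a = V - (span {pd Cuxx, pd Cuxy, pd Cuyy} - {0})"
    using closure_char_union[OF a] char_union_eq_diff[OF a]
    by (simp add: Let_def char_frame_def)
next
  have M: "open M" "M \<subseteq> J2_minus"
    using open_generic by (auto simp: M_def)
  have cl: "closure (char_union a) = span ((\<lambda>i. char_frame i a) ` {..<3})" if "a \<in> M" for a
    using closure_char_union[of a] that by (simp add: M_def frame_image)
  have "dim (closure (char_union a)) = 3" if "a \<in> M" for a
    using closure_char_union[of a] dim_span_char_frame[of a] that by (simp add: M_def)
  \<comment> \<open>The frame is defined on all of \<open>M\<close>, so \<open>W = M\<close> works
    as the neighbourhood of every point.\<close>
  then show "vector_distribution 3 M (\<lambda>a. closure (char_union a))"
    unfolding vector_distribution_def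
    using M cl smooth_on_char_frame[OF M] by (auto intro!: exI[of _ M] exI[of _ char_frame])
qed

end
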